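(* Let $I=(\mathcal{M},\mathcal{J})$ be an instance of the makespan scheduling problem with feasibility AF $(\mathrm{Args}_F,\rightsquigarrow_F)$, let $S$ be a schedule, let $E\subseteq\mathrm{Args}_F$ be the extension corresponding to $S$ ($S\approx E$), and let $(\mathrm{Args}_S,\rightsquigarrow_S)$ be the optimality AF of $S$. Then $E$ is stable in $(\mathrm{Args}_S,\rightsquigarrow_S)$ if and only if $S$ is feasible and satisfies both the Single Exchange Property (SEP) and the Pairwise Exchange Property (PEP).
   Context: Makespan scheduling. An instance is a pair $(\mathcal{M},\mathcal{J})$ with machines $\mathcal{M}=\{1,\dots,m\}$ and jobs $\mathcal{J}=\{1,\dots,n\}$, $m,n\geq 1$, where each job $j$ has a processing time $p_j\ge 0$. A schedule is a matrix $S=(x_{i,j})\in\{0,1\}^{m\times n}$ ($x_{i,j}=1$ means job $j$ is assigned to machine $i$); no further constraint is imposed on a schedule. For a schedule $S$, $C_i=\sum_{j=1}^n x_{i,j}p_j$ is the completion time of machine $i$ and $C_{\max}=\max_{i}C_i$ is the makespan. $S$ is feasible iff it meets the constraints $C_{\max}\geq C_i$ and $C_i=\sum_{j} x_{i,j}p_j$ for all $i\in\mathcal{M}$, and $\sum_{i=1}^m x_{i,j}=1$ for all $j\in\mathcal{J}$. Exchange properties. $S$ satisfies SEP (respectively PEP) iff for every machine $i$ and job $j$ with $x_{i,j}=1$ and $C_i=C_{\max}$ (a critical job), and every machine $i'\neq i$: - SEP: $C_i-C_{i'}\leq p_j$; - PEP: for any job $j'\neq j$ with $x_{i',j'}=1$,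 if $p_j>p_{j'}$ then $C_i+p_{j'}\leq C_{i'}+p_j$. Abstract argumentation. An abstract argumentation framework (AF) is a directed graph $(\mathrm{Args},\rightsquigarrow)$ with a set $\mathrm{Args}$ of arguments and a binary attack relation $\rightsquigarrow$ on $\mathrm{Args}$. An extension is a set $E\subseteq\mathrm{Args}$. It is conflict-free iff there are no $a,b\in E$ with $a\rightsquigarrow b$; it is stable iff it is conflict-free and for every $b\in\mathrm{Args}\setminus E$ there is $a\in E$ with $a\rightsquigarrow b$. Feasibility AF: $\mathrm{Args}_F=\{a_{i,j}: i\in\mathcal{M}, j\in\mathcal{J}\}$ (pairwise distinct arguments) and $a_{i,j}\rightsquigarrow_F a_{k,l}$ iff $i\neq k$ and $j=l$. Correspondence: $S\approx E$ means that for all $i,j$: $x_{i,j}=1$ iff $a_{i,j}\in E$. Optimality AF of $S$: $\mathrm{Args}_S=\mathrm{Args}_F$ and $$\rightsquigarrow_S\;=\;\bigl(\rightsquigarrow_F\setminus\{(a_{i,j},a_{i',j}): C_i=C_{\max},\,x_{i,j}=1,\,C_i>C_{i'}+p_j\}\bigr)\cup\{(a_{i',j'},a_{i,j}): C_i=C_{\max},\,x_{i,j}=1,\,x_{i',j'}=1,\,i'\neq i,\,j'\neq j,\,p_j>p_{j'},\,C_i+p_{j'}>C_{i'}+p_j\}.$$ *)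

theory Defs
  imports Complex_Main "Graph_Theory.Pair_Digraph"
begin

record problem =
  num_machines :: nat
  num_jobs :: nat
  ptime :: "nat \<Rightarrow> real"

definition machines :: "problem \<Rightarrow> nat set" where
  "machines I = {1..num_machines I}"

definition jobs :: "problem \<Rightarrow> nat set" where
  "jobs I = {1..num_jobs I}"

definition makespan_problem :: "problem \<Rightarrow> bool" where
  "makespan_problem I \<longleftrightarrow>
     num_machines I \<ge> 1 \<and> num_jobs I \<ge> 1 \<and> (\<forall>j\<in>jobs I. ptime I j \<ge> 0)"

text \<open>
  A matrix is a function of its two indices, of which only the values on
  \<open>machines I \<times> jobs I\<close> are relevant. A schedule need not assign every job exactly once;
  that is part of feasibility.
\<close>

type_synonym matrix01 = "nat \<Rightarrow> nat \<Rightarrow> nat"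

definition schedule :: "problem \<Rightarrow> matrix01 \<Rightarrow> bool" where
  "schedule I x \<longleftrightarrow> (\<forall>i\<in>machines I. \<forall>j\<in>jobs I. x i j \<in> {0, 1})"

definition completion :: "problem \<Rightarrow> matrix01 \<Rightarrow> nat \<Rightarrow> real" where
  "completion I x i = (\<Sum>j\<in>jobs I. real (x i j) * ptime I j)"

definition makespan :: "problem \<Rightarrow> matrix01 \<Rightarrow> real" where
  "makespan I x = Max (completion I x ` machines I)"

text \<open>
  The first two constraints hold automatically because completion times and makespan are
  functions of the schedule; they are kept because they belong to the integer program
  that defines feasibility.
\<close>

definition feasible :: "problem \<Rightarrow> matrix01 \<Rightarrow> bool" where
  "feasible I x \<longleftrightarrow>
     (\<forall>i\<in>machines I. makespan I x \<ge> completion I x i) \<and>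
     (\<forall>i\<in>machines I. completion I x i = (\<Sum>j\<in>jobs I. real (x i j) * ptime I j)) \<and>
     (\<forall>j\<in>jobs I. (\<Sum>i\<in>machines I. x i j) = 1)"

definition critical :: "problem \<Rightarrow> matrix01 \<Rightarrow> nat \<Rightarrow> nat \<Rightarrow> bool" where
  "critical I x i j \<longleftrightarrow> x i j = 1 \<and> completion I x i = makespan I x"

definition SEP :: "problem \<Rightarrow> matrix01 \<Rightarrow> bool" where
  "SEP I x \<longleftrightarrow>
     (\<forall>i\<in>machines I. \<forall>j\<in>jobs I. critical I x i j \<longrightarrow>
        (\<forall>i'\<in>machines I. i' \<noteq> i \<longrightarrow>
           completion I x i - completion I x i' \<le> ptime I j))"

definition PEP :: "problem \<Rightarrow> matrix01 \<Rightarrow> bool" where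
  "PEP I x \<longleftrightarrow>
     (\<forall>i\<in>machines I. \<forall>j\<in>jobs I. critical I x i j \<longrightarrow>
        (\<forall>i'\<in>machines I. i' \<noteq> i \<longrightarrow>
           (\<forall>j'\<in>jobs I. j' \<noteq> j \<longrightarrow> x i' j' = 1 \<longrightarrow> ptime I j > ptime I j' \<longrightarrow>
              completion I x i + ptime I j' \<le> completion I x i' + ptime I j)))"

text \<open>
  An argumentation framework is a digraph without parallel arcs: \<open>pverts\<close> are the
  arguments and \<open>parcs\<close> is the attack relation.
\<close>

definition conflict_free :: "'a pair_pre_digraph \<Rightarrow> 'a set \<Rightarrow> bool" where
  "conflict_free G E \<longleftrightarrow> \<not> (\<exists>a\<in>E. \<exists>b\<in>E. (a, b) \<in> parcs G)"

definition stable :: "'a pair_pre_digraph \<Rightarrow> 'a set \<Rightarrow> bool" where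
  "stable G E \<longleftrightarrow>
     conflict_free G E \<and> (\<forall>b \<in> pverts G - E. \<exists>a\<in>E. (a, b) \<in> parcs G)"

text \<open>\<open>Assign i j\<close> is the argument \<open>a\<^sub>i\<^sub>,\<^sub>j\<close>.\<close>

datatype argument = Assign nat nat

definition feasibility_AF :: "problem \<Rightarrow> argument pair_pre_digraph" where
  "feasibility_AF I =
     \<lparr> pverts = {Assign i j |i j. i \<in> machines I \<and> j \<in> jobs I},
       parcs = {(Assign i j, Assign k l) |i j k l.
          i \<in> machines I \<and> j \<in> jobs I \<and> k \<in> machines I \<and> l \<in> jobs I \<and>
          i \<noteq> k \<and> j = l} \<rparr>"

definition corresponds :: "problem \<Rightarrow> matrix01 \<Rightarrow> argument set \<Rightarrow> bool" where
  "corresponds I x E \<longleftrightarrow>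
     (\<forall>i\<in>machines I. \<forall>j\<in>jobs I. x i j = 1 \<longleftrightarrow> Assign i j \<in> E)"

definition optimality_AF :: "problem \<Rightarrow> matrix01 \<Rightarrow> argument pair_pre_digraph" where
  "optimality_AF I x =
     \<lparr> pverts = pverts (feasibility_AF I),
       parcs =
         (parcs (feasibility_AF I) -
          {(Assign i j, Assign i' j) |i j i'.
             i \<in> machines I \<and> j \<in> jobs I \<and> i' \<in> machines I \<and>
             completion I x i = makespan I x \<and> x i j = 1 \<and>
             completion I x i > completion I x i' + ptime I j})
         \<union>
         {(Assign i' j', Assign i j) |i j i' j'.
             i \<in> machines I \<and> j \<in> jobs I \<and> i' \<in> machines I \<and> j' \<in> jobs I \<and>
             completion I x i = makespan I x \<and> x i j = 1 \<and> x i' j' = 1 \<and>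
             i' \<noteq> i \<and> j' \<noteq> j \<and> ptime I j > ptime I j' \<and>
             completion I x i + ptime I j' > completion I x i' + ptime I j} \<rparr>"

lemma pair_wf_digraph_feasibility_AF: "pair_wf_digraph (feasibility_AF I)"
  by unfold_locales (auto simp: feasibility_AF_def)

lemma pair_wf_digraph_optimality_AF: "pair_wf_digraph (optimality_AF I x)"
  by unfold_locales (auto simp: optimality_AF_def feasibility_AF_def)

end

theory Submission
  imports Defs
begin

text \<open>
  The attacks deleted from the feasibility AF are exactly the violations of SEP, and the
  added ones exactly the violations of PEP. Two machines sharing a job still conflict, since
  processing times are nonnegative and so at most one of the two mutual attacks is deleted.
  Added attacks only target members of \<open>E\<close>, so an argument outside \<open>E\<close> can only be attacked
  through its own job: stability forces every job to be assigned, and forces the attacks of its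
  unique assignment to survive.
\<close>

lemma pverts_optimality_AF_iff [simp]:
  "Assign i j \<in> pverts (optimality_AF I x) \<longleftrightarrow> i \<in> machines I \<and> j \<in> jobs I"
  by (auto simp: optimality_AF_def feasibility_AF_def)

text \<open>Deleted attacks join arguments of one job and added attacks arguments of different jobs,
  so difference and union do not interact and \<open>j = l\<close> separates them.\<close>

lemma parcs_optimality_AF_iff:
  "(Assign i j, Assign k l) \<in> parcs (optimality_AF I x) \<longleftrightarrow>
     i \<in> machines I \<and> k \<in> machines I \<and> j \<in> jobs I \<and> l \<in> jobs I \<and> i \<noteq> k \<and>
     (if j = l then \<not> (critical I x i j \<and> completion I x i > completion I x k + ptime I j)
      else critical I x k l \<and> x i j = 1 \<and> ptime I l > ptime I j \<and>
        completion I x k + ptime I j > completion I x i + ptime I l)"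
  by (auto simp: optimality_AF_def feasibility_AF_def critical_def)

lemma completion_le_makespan:
  "i \<in> machines I \<Longrightarrow> completion I x i \<le> makespan I x"
  by (simp add: makespan_def machines_def)

text \<open>A sum of naturals is 1 exactly when one summand is 1 and the others vanish; for entries
  of a schedule, vanishing means differing from 1.\<close>

lemma feasible_iff_ex1:
  assumes "schedule I x"
  shows "feasible I x \<longleftrightarrow> (\<forall>j\<in>jobs I. \<exists>!i. i \<in> machines I \<and> x i j = 1)"
proof -
  have "(\<Sum>i\<in>machines I. x i j) = 1 \<longleftrightarrow> (\<exists>!i. i \<in> machines I \<and> x i j = 1)"
    if "j \<in> jobs I" for j
  proof -
    have "x i j \<noteq> 1 \<longleftrightarrow> x i j = 0" if "i \<in> machines I" for i
      using assms that \<open>j \<in> jobs I\<close> by (auto simp: schedule_def)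
    moreover have "finite (machines I)"
      by (simp add: machines_def)
    ultimately show ?thesis
      by (subst sum_eq_1_iff) (assumption, metis)
  qed
  then show ?thesis
    unfolding feasible_def completion_def[symmetric] by (simp add: completion_le_makespan)
qed

theorem theorem2:
  fixes I :: problem and S :: matrix01 and E :: "argument set"
  assumes "makespan_problem I"
    and "schedule I S"
    and "E \<subseteq> pverts (feasibility_AF I)"
    and "corresponds I S E"
  shows "stable (optimality_AF I S) E \<longleftrightarrow> feasible I S \<and> SEP I S \<and> PEP I S"
proof
  let ?A = "parcs (optimality_AF I S)" and ?C = "completion I S"
  \<comment> \<open>Correspondence constrains only indices in range; the others are excluded because
    \<open>E\<close> consists of arguments.\<close>
  have mem: "Assign i j \<in> E \<longleftrightarrow> i \<in> machines I \<and> j \<in> jobs I \<and> S i j = 1" for i j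
    using assms(3,4) by (auto simp: corresponds_def feasibility_AF_def)
  have ptime_nonneg: "ptime I j \<ge> 0" if "j \<in> jobs I" for j
    using assms(1) that by (simp add: makespan_problem_def)
  {
    assume st: "stable (optimality_AF I S) E"
    then have no_attack: "(a, b) \<notin> ?A" if "a \<in> E" "b \<in> E" for a b
      using that by (auto simp: stable_def conflict_free_def)
    have unique: "i = k" if "Assign i j \<in> E" "Assign k j \<in> E" for i k j
    proof (rule ccontr)
      assume "i \<noteq> k"
      \<comment> \<open>Neither attack is present, so both were deleted; adding the two inequalities
        gives \<open>2 * ptime I j < 0\<close>.\<close>
      with that no_attack[OF that] no_attack[OF that(2,1)]
      have "?C i > ?C k + ptime I j" "?C k > ?C i + ptime I j" "j \<in> jobs I"
        by (auto simp: parcs_optimality_AF_iff mem)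
      then show False
        using ptime_nonneg[of j] by simp
    qed
    have attacker: "\<exists>k. Assign k j \<in> E \<and> (Assign k j, Assign i j) \<in> ?A"
      if "i \<in> machines I" "j \<in> jobs I" "Assign i j \<notin> E" for i j
    proof -
      from that have "Assign i j \<in> pverts (optimality_AF I S) - E"
        by simp
      with st obtain a where "a \<in> E" "(a, Assign i j) \<in> ?A"
        unfolding stable_def by blast
      moreover obtain k l where "a = Assign k l"
        by (cases a)
      \<comment> \<open>If \<open>l \<noteq> j\<close>, the attack would make \<open>i\<close>,
        \<open>j\<close> critical and so put \<open>Assign i j\<close> into
        \<open>E\<close>.\<close>
      ultimately show ?thesis
        using that by (auto simp: parcs_optimality_AF_iff mem critical_def split: if_splits)
    qed
    have "\<exists>i. Assign i j \<in> E" if "j \<in> jobs I" for j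
    proof -
      \<comment> \<open>Any machine will do: either it has job \<open>j\<close> itself, or the
        attacker of its argument is a member for job \<open>j\<close>.\<close>
      have "1 \<in> machines I"
        using assms(1) by (simp add: makespan_problem_def machines_def)
      then show ?thesis
        using attacker that by blast
    qed
    then have "feasible I S"
      using unique unfolding feasible_iff_ex1[OF assms(2)] by (metis mem)
    moreover have "SEP I S"
      unfolding SEP_def
    proof (intro ballI impI)
      fix i j k
      assume *: "i \<in> machines I" "j \<in> jobs I" "critical I S i j" "k \<in> machines I" "k \<noteq> i"
      then have "Assign i j \<in> E"
        by (simp add: mem critical_def)
      \<comment> \<open>By uniqueness \<open>Assign k j\<close> lies outside \<open>E\<close>, and
        its attacker can only be \<open>Assign i j\<close>.\<close>
      with * unique attacker[of k j] have "(Assign i j, Assign k j) \<in> ?A"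
        by blast
      with * show "?C i - ?C k \<le> ptime I j"
        by (auto simp: parcs_optimality_AF_iff)
    qed
    moreover have "PEP I S"
      unfolding PEP_def
    proof (intro ballI impI)
      fix i j k l
      assume *: "i \<in> machines I" "j \<in> jobs I" "critical I S i j" "k \<in> machines I" "k \<noteq> i"
        "l \<in> jobs I" "l \<noteq> j" "S k l = 1" "ptime I l < ptime I j"
      \<comment> \<open>Both arguments are in \<open>E\<close>, so a violation of PEP would be a
        conflict inside \<open>E\<close>.\<close>
      then have "(Assign k l, Assign i j) \<notin> ?A"
        by (intro no_attack) (simp_all add: mem critical_def)
      with * show "?C i + ptime I l \<le> ?C k + ptime I j"
        by (simp add: parcs_optimality_AF_iff)
    qed
    ultimately show "feasible I S \<and> SEP I S \<and> PEP I S"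
      by blast
  next
    assume R: "feasible I S \<and> SEP I S \<and> PEP I S"
    then have ex1: "\<exists>!i. i \<in> machines I \<and> S i j = 1" if "j \<in> jobs I" for j
      using that feasible_iff_ex1[OF assms(2)] by blast
    \<comment> \<open>SEP leaves nothing to delete and PEP nothing to add, so the attacks are those
      of the feasibility AF, for which assigning each job exactly once gives stability.\<close>
    have attack_iff: "(Assign i j, Assign k l) \<in> ?A \<longleftrightarrow>
        i \<in> machines I \<and> k \<in> machines I \<and> j \<in> jobs I \<and> i \<noteq> k \<and> j = l" for i j k l
      using R unfolding parcs_optimality_AF_iff SEP_def PEP_def by (smt (verit))
    have "(a, b) \<notin> ?A" if "a \<in> E" "b \<in> E" for a b
      using that by (cases a; cases b) (use ex1 in \<open>auto simp: attack_iff mem\<close>)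
    moreover have "\<exists>a\<in>E. (a, b) \<in> ?A" if "b \<in> pverts (optimality_AF I S) - E" for b
    proof (cases b)
      case (Assign k j)
      with that have kj: "k \<in> machines I" "j \<in> jobs I" "S k j \<noteq> 1"
        by (auto simp: mem)
      with ex1 obtain i where "i \<in> machines I" "S i j = 1"
        by blast
      with kj Assign show ?thesis
        by (intro bexI[of _ "Assign i j"]) (auto simp: attack_iff mem)
    qed
    ultimately show "stable (optimality_AF I S) E"
      by (auto simp: stable_def conflict_free_def)
  }
qed

end
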